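(* Suppose $(M_n)_{n\ge0}$ is a nonanalytic weight sequence, $\phi$ is analytic on $\bar\Delta$, $\phi:\bar\Delta\to\bar\Delta$, and $\phi$ is not an inner function. Suppose that for all positive integers $N$ there is no fixed point of $\phi_N$ on the unit circle. Then there is some $N_1$ such that $\phi_N$ induces an endomorphism of $D(\bar\Delta,M)$ for all $N\ge N_1$.
   Context: $\Delta$ is the open unit disc in $\mathbb{C}$ and $\bar\Delta$ the closed unit disc. A self-map $\phi$ of $\bar\Delta$ is analytic on $\bar\Delta$ if it extends to an analytic function on a neighborhood of $\bar\Delta$. $\phi_N$ denotes the $N$-th iterate of $\phi$ ($N$-fold composition). An inner function is an analytic function $\phi$ on $\Delta$ with $|\phi(z)|\le1$ on $\Delta$ and $|\phi(e^{i\theta})|=1$ for almost all $\theta$. A function $f:\bar\Delta\to\mathbb{C}$ is complex-differentiable at $a\in\bar\Delta$ if $f'(a)=\lim_{z\to a,\ z\in\bar\Delta}\frac{f(z)-f(a)}{z-a}$ exists; higher derivatives $f^{(n)}$ are defined by iteration, and $D^\infty(\bar\Delta)$ is the set of infinitely complex-differentiable functions on $\bar\Delta$. $\|\cdot\|_\infty$ is the sup norm over $\bar\Delta$. A weight sequence is a sequence $(M_n)_{n\ge0}$ of positive numbers with $M_0=1$ and $\binom{m+n}{n}\le\frac{M_{m+n}}{M_mM_n}$ for all $m,n\ge0$. It is nonanalytic if $\lim_{n\to\infty}(n!/M_n)^{1/n}=0$. Define $D(\bar\Delta,M)=\{f\in D^\infty(\bar\Delta):\|f\|_{D(\bar\Delta,M)}=\sum_{n=0}^\infty\frac{\|f^{(n)}\|_\infty}{M_n}<\infty\}$,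 a Banach algebra under pointwise operations. A map $\psi:\bar\Delta\to\bar\Delta$ induces an endomorphism of $D(\bar\Delta,M)$ if $f\circ\psi\in D(\bar\Delta,M)$ for all $f\in D(\bar\Delta,M)$. *)

theory Defs
  imports "HOL-Analysis.Analysis"
begin

text \<open>
  Self-maps of, and functions on, the closed unit disc are represented by total functions
  on \<^typ>\<open>complex\<close>; none of the notions below depends on values outside \<^term>\<open>cball 0 1 :: complex set\<close>.
\<close>

definition analytic_on_closed_disc :: "(complex \<Rightarrow> complex) \<Rightarrow> bool" where
  "analytic_on_closed_disc \<phi> \<longleftrightarrow>
     (\<exists>U g. open U \<and> cball 0 1 \<subseteq> U \<and> g holomorphic_on U \<and> (\<forall>z\<in>cball 0 1. g z = \<phi> z))"

text \<open>The boundary value at \<^term>\<open>cis \<theta>\<close> is the radial limit, so only values in the open disc matter.\<close>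

definition inner_function :: "(complex \<Rightarrow> complex) \<Rightarrow> bool" where
  "inner_function \<phi> \<longleftrightarrow>
     \<phi> holomorphic_on ball 0 1 \<and>
     (\<forall>z\<in>ball 0 1. norm (\<phi> z) \<le> 1) \<and>
     (AE \<theta> in lborel. \<exists>w. ((\<lambda>r. \<phi> (of_real r * cis \<theta>)) \<longlongrightarrow> w) (at_left (1::real)) \<and> norm w = 1)"

text \<open>
  The complex derivative relative to the closed disc; unlike \<^const>\<open>deriv\<close>, at boundary points
  the limit is taken within the disc. It is a junk value where that limit does not exist.
\<close>

definition disc_deriv :: "(complex \<Rightarrow> complex) \<Rightarrow> complex \<Rightarrow> complex" where
  "disc_deriv f a = (THE d. (f has_field_derivative d) (at a within cball 0 1))"

lemma disc_deriv_eq: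
  assumes "(f has_field_derivative d) (at a within cball 0 1)" and "a \<in> cball 0 1"
  shows "disc_deriv f a = d"
proof -
  have "a islimpt (cball 0 1 :: complex set)"
    using assms(2) islimpt_ball[of a 0 1] islimpt_subset[OF _ ball_subset_cball] by force
  hence ne: "at a within cball 0 1 \<noteq> (bot :: complex filter)"
    by (simp add: trivial_limit_within)
  show ?thesis
    unfolding disc_deriv_def
  proof (rule the_equality)
    show "(f has_field_derivative d) (at a within cball 0 1)" by (rule assms(1))
  next
    fix e assume "(f has_field_derivative e) (at a within cball 0 1)"
    with assms(1) show "e = d"
      unfolding has_field_derivative_iff using tendsto_unique[OF ne] by blast
  qed
qed

definition D_infty :: "(complex \<Rightarrow> complex) set" where
  "D_infty = {f. \<forall>n. \<forall>a\<in>cball 0 1. ((disc_deriv ^^ n) f) field_differentiable (at a within cball 0 1)}"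

text \<open>
  For \<^term>\<open>f \<in> D_infty\<close> all iterated derivatives are continuous on the closed disc, so the
  supremum below is taken over a bounded set.
\<close>

definition disc_norm :: "(complex \<Rightarrow> complex) \<Rightarrow> real" where
  "disc_norm f = (SUP z\<in>cball 0 1. norm (f z))"

definition weight_sequence :: "(nat \<Rightarrow> real) \<Rightarrow> bool" where
  "weight_sequence M \<longleftrightarrow>
     (\<forall>n. M n > 0) \<and> M 0 = 1 \<and>
     (\<forall>m n. real ((m + n) choose n) \<le> M (m + n) / (M m * M n))"

definition nonanalytic_weight :: "(nat \<Rightarrow> real) \<Rightarrow> bool" where
  "nonanalytic_weight M \<longleftrightarrow> (\<lambda>n. root n (fact n / M n)) \<longlonglongrightarrow> 0"

definition D_space :: "(nat \<Rightarrow> real) \<Rightarrow> (complex \<Rightarrow> complex) set" where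
  "D_space M = {f \<in> D_infty. summable (\<lambda>n. disc_norm ((disc_deriv ^^ n) f) / M n)}"

definition induces_endomorphism :: "(nat \<Rightarrow> real) \<Rightarrow> (complex \<Rightarrow> complex) \<Rightarrow> bool" where
  "induces_endomorphism M \<psi> \<longleftrightarrow>
     \<psi> \<in> cball 0 1 \<rightarrow> cball 0 1 \<and> (\<forall>f\<in>D_space M. f \<circ> \<psi> \<in> D_space M)"

end

theory Submission
  imports Defs "HOL-Complex_Analysis.Conformal_Mappings"
begin

text \<open>
  Let \<open>E\<close> be the set of points of the unit circle that \<open>\<phi>\<close> maps to the unit circle.
  Because \<open>\<phi>\<close> is analytic across the circle, so is the function \<open>\<bar>\<phi>\<bar>\<^sup>2 - 1\<close> in the real variable
  \<open>\<theta>\<close>; it therefore vanishes identically or has finitely many zeros modulo \<open>2\<pi>\<close>. In the first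
  case \<open>\<phi>\<close> would be inner, so \<open>E\<close> is finite (\<open>finite_unimodular_or_inner\<close>).

  By the maximum principle a point whose image lies on the circle is itself on the circle (a
  unimodular constant is excluded because it would fix a point of the circle). Hence if
  \<open>\<bar>\<phi>\<^sub>N(z)\<bar> = 1\<close>, then \<open>z, \<phi>(z), \<dots>, \<phi>\<^sub>N\<^sub>-\<^sub>1(z)\<close> all lie in \<open>E\<close>. For \<open>N\<close> larger than the cardinality
  of \<open>E\<close> two of these coincide, which gives a fixed point of some iterate on the circle.
  So for all such \<open>N\<close> the closed disc is mapped by \<open>\<phi>\<^sub>N\<close> into the open disc
  (\<open>iterates_into_open_disc\<close>).

  Finally, if \<open>\<psi>\<close> is analytic on the closed disc with values in the open disc and \<open>f\<close> is in
  \<open>D(M)\<close>, then \<open>f \<circ> \<psi>\<close> is again analytic on the closed disc, because \<open>f\<close> is holomorphic on the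
  open disc. Cauchy's estimates bound its \<open>n\<close>-th derivative by \<open>B n! / r\<^sup>n\<close>, and
  \<open>(n!/M\<^sub>n)\<^sup>1\<^sup>/\<^sup>n \<rightarrow> 0\<close> makes \<open>\<Sum> B n! / (r\<^sup>n M\<^sub>n)\<close> converge (\<open>analytic_in_D_space\<close>).
\<close>

section \<open>Functions analytic on the closed disc\<close>

lemma analytic_on_closed_disc_iff:
  "analytic_on_closed_disc \<phi> \<longleftrightarrow> (\<exists>g. g analytic_on cball 0 1 \<and> (\<forall>z\<in>cball 0 1. g z = \<phi> z))"
  unfolding analytic_on_closed_disc_def analytic_on_holomorphic by blast

lemma analytic_on_closed_disc_compose:
  assumes "analytic_on_closed_disc \<psi>" "k analytic_on \<psi> ` cball 0 1"
    and "\<And>z. z \<in> cball 0 1 \<Longrightarrow> f (\<psi> z) = k (\<psi> z)"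
  shows "analytic_on_closed_disc (f \<circ> \<psi>)"
proof -
  obtain g where g: "g analytic_on cball 0 1" "\<And>z. z \<in> cball 0 1 \<Longrightarrow> g z = \<psi> z"
    using assms(1) unfolding analytic_on_closed_disc_iff by blast
  have "g ` cball 0 1 = \<psi> ` cball 0 1"
    using g(2) by (rule image_cong[OF refl])
  then have "(k \<circ> g) analytic_on cball 0 1"
    using analytic_on_compose[OF g(1)] assms(2) by simp
  moreover have "(k \<circ> g) z = (f \<circ> \<psi>) z" if "z \<in> cball 0 1" for z
    using that g(2) assms(3) by simp
  ultimately show ?thesis
    unfolding analytic_on_closed_disc_iff by blast
qed

lemma funpow_closed_disc:
  fixes \<phi> :: "complex \<Rightarrow> complex"
  assumes "\<phi> \<in> cball 0 1 \<rightarrow> cball 0 1" "z \<in> cball 0 1"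
  shows "(\<phi> ^^ N) z \<in> cball 0 1"
proof (induction N)
  case 0
  show ?case using assms(2) by simp
next
  case (Suc N)
  have "\<phi> ((\<phi> ^^ N) z) \<in> cball 0 1"
    using assms(1) Suc by (rule funcset_mem)
  then show ?case by simp
qed

lemma analytic_on_closed_disc_funpow:
  assumes "analytic_on_closed_disc \<phi>" "\<phi> \<in> cball 0 1 \<rightarrow> cball 0 1"
  shows "analytic_on_closed_disc (\<phi> ^^ N)"
proof (induction N)
  case 0
  have "(\<lambda>z. z) analytic_on cball 0 1" by (rule analytic_on_ident)
  then show ?case
    unfolding analytic_on_closed_disc_iff by (intro exI[of _ "\<lambda>z. z"]) simp
next
  case (Suc N)
  obtain g where g: "g analytic_on cball 0 1" "\<And>z. z \<in> cball 0 1 \<Longrightarrow> g z = \<phi> z"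
    using assms(1) unfolding analytic_on_closed_disc_iff by blast
  have maps: "(\<phi> ^^ N) z \<in> cball 0 1" if "z \<in> cball 0 1" for z
    using funpow_closed_disc[OF assms(2) that] .
  have "g analytic_on (\<phi> ^^ N) ` cball 0 1"
    using g(1) by (rule analytic_on_subset) (use maps in blast)
  then have "analytic_on_closed_disc (\<phi> \<circ> (\<phi> ^^ N))"
    by (rule analytic_on_closed_disc_compose[OF Suc]) (use g(2) maps in metis)
  then show ?case by (simp only: funpow.simps)
qed

lemma analytic_on_closed_disc_imp_continuous_on:
  assumes "analytic_on_closed_disc \<phi>"
  shows "continuous_on (cball 0 1) \<phi>"
proof -
  obtain g where g: "g analytic_on cball 0 1" "\<And>z. z \<in> cball 0 1 \<Longrightarrow> g z = \<phi> z"
    using assms unfolding analytic_on_closed_disc_iff by blast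
  have "continuous_on (cball 0 1) g"
    using g(1) by (intro holomorphic_on_imp_continuous_on analytic_imp_holomorphic)
  with g(2) show ?thesis
    by (metis continuous_on_cong)
qed

lemma analytic_on_closed_disc_imp_holomorphic_on:
  assumes "analytic_on_closed_disc \<phi>"
  shows "\<phi> holomorphic_on ball 0 1"
proof -
  obtain g where g: "g analytic_on cball 0 1" "\<And>z. z \<in> cball 0 1 \<Longrightarrow> g z = \<phi> z"
    using assms unfolding analytic_on_closed_disc_iff by blast
  have "g holomorphic_on ball 0 1"
    using g(1) by (meson analytic_imp_holomorphic analytic_on_subset ball_subset_cball)
  then show ?thesis
    by (rule holomorphic_transform) (use g(2) in auto)
qed

section \<open>Analytic functions belong to the weighted algebra\<close>

lemma disc_deriv_funpow_eq_deriv: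
  assumes "open U" "cball 0 1 \<subseteq> U" "g holomorphic_on U"
    and "\<And>z. z \<in> cball 0 1 \<Longrightarrow> h z = g z" and "a \<in> cball 0 1"
  shows "(disc_deriv ^^ n) h a = (deriv ^^ n) g a"
    and "((disc_deriv ^^ n) h has_field_derivative (deriv ^^ Suc n) g a) (at a within cball 0 1)"
proof -
  have step: "((disc_deriv ^^ n) h has_field_derivative (deriv ^^ Suc n) g a) (at a within cball 0 1)"
    if "\<forall>z\<in>cball 0 1. (disc_deriv ^^ n) h z = (deriv ^^ n) g z" "a \<in> cball 0 1" for n a
  proof (rule has_field_derivative_transform_within[OF _ zero_less_one that(2)])
    show "((deriv ^^ n) g has_field_derivative (deriv ^^ Suc n) g a) (at a within cball 0 1)"
      using has_field_derivative_higher_deriv[OF assms(3,1), of a n] that(2) assms(2)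
      by (meson has_field_derivative_at_within subsetD)
  qed (use that(1) in auto)
  have eq: "\<forall>a\<in>cball 0 1. (disc_deriv ^^ n) h a = (deriv ^^ n) g a" for n
  proof (induction n)
    case 0
    then show ?case using assms(4) by simp
  next
    case (Suc n)
    show ?case
    proof
      fix a :: complex assume "a \<in> cball 0 1"
      from disc_deriv_eq[OF step[OF Suc this] this]
      show "(disc_deriv ^^ Suc n) h a = (deriv ^^ Suc n) g a" by simp
    qed
  qed
  show "(disc_deriv ^^ n) h a = (deriv ^^ n) g a"
    using eq assms(5) by blast
  show "((disc_deriv ^^ n) h has_field_derivative (deriv ^^ Suc n) g a) (at a within cball 0 1)"
    using step[OF eq assms(5)] .
qed

lemma higher_deriv_bound_on_compact:
  fixes g :: "complex \<Rightarrow> complex"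
  assumes "open U" "compact K" "K \<subseteq> U" "g holomorphic_on U"
  obtains B r where "r > 0" "\<And>n z. z \<in> K \<Longrightarrow> norm ((deriv ^^ n) g z) \<le> fact n * B / r ^ n"
proof -
  obtain e where e: "e > 0" "(\<Union>x\<in>K. ball x e) \<subseteq> U"
    using compact_subset_open_imp_ball_epsilon_subset[OF assms(2,1,3)] .
  define r where "r = e / 2"
  have r: "r > 0" using e(1) by (simp add: r_def)
  define L where "L = {a + b | a b. a \<in> K \<and> b \<in> cball 0 r}"
  have "compact L"
    unfolding L_def using assms(2) compact_cball by (rule compact_sums)
  have cb: "cball a r \<subseteq> L" if "a \<in> K" for a
  proof
    fix w assume "w \<in> cball a r"
    then have "w - a \<in> cball 0 r" "w = a + (w - a)"
      by (auto simp: dist_norm norm_minus_commute)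
    with that show "w \<in> L" unfolding L_def by blast
  qed
  have cbU: "cball a r \<subseteq> U" if "a \<in> K" for a
    using that e r_def by fastforce
  have "L \<subseteq> U"
  proof
    fix w assume "w \<in> L"
    then obtain a b where "a \<in> K" "b \<in> cball 0 r" "w = a + b" unfolding L_def by blast
    then have "w \<in> cball a r" by (simp add: dist_norm)
    with cbU \<open>a \<in> K\<close> show "w \<in> U" by blast
  qed
  then have "continuous_on L g"
    using assms(4) by (meson holomorphic_on_imp_continuous_on continuous_on_subset)
  then have "bounded (g ` L)"
    using \<open>compact L\<close> by (intro compact_imp_bounded compact_continuous_image)
  then obtain B where B: "\<And>w. w \<in> L \<Longrightarrow> norm (g w) \<le> B"
    unfolding bounded_iff by blast
  have "norm ((deriv ^^ n) g z) \<le> fact n * B / r ^ n" if "z \<in> K" for n z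
  proof (rule Cauchy_inequality[OF _ _ r])
    show "g holomorphic_on ball z r"
      using assms(4) cbU[OF that] by (meson holomorphic_on_subset ball_subset_cball order_trans)
    show "continuous_on (cball z r) g"
      using assms(4) cbU[OF that] by (meson holomorphic_on_imp_continuous_on continuous_on_subset)
    show "norm (g x) \<le> B" if "norm (z - x) = r" for x
      using B cb[OF \<open>z \<in> K\<close>] that by (auto simp: dist_norm)
  qed
  with r show thesis by (rule that)
qed

lemma analytic_in_D_space:
  assumes M: "\<And>n. M n > 0" and "nonanalytic_weight M" and "analytic_on_closed_disc h"
  shows "h \<in> D_space M"
proof -
  obtain U g where U: "open U" "cball 0 1 \<subseteq> U" "g holomorphic_on U"
    and gh: "\<And>z. z \<in> cball 0 1 \<Longrightarrow> h z = g z"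
    using assms(3) unfolding analytic_on_closed_disc_def by metis
  note D = disc_deriv_funpow_eq_deriv[OF U gh]
  have "h \<in> D_infty"
    unfolding D_infty_def field_differentiable_def using D(2) by blast
  obtain B r where r: "r > 0"
    and Br: "\<And>n z. z \<in> cball 0 1 \<Longrightarrow> norm ((deriv ^^ n) g z) \<le> fact n * B / r ^ n"
    using higher_deriv_bound_on_compact[OF U(1) compact_cball U(2,3)] by metis
  have dn_le: "disc_norm ((disc_deriv ^^ n) h) \<le> fact n * B / r ^ n" for n
    unfolding disc_norm_def by (rule cSUP_least) (use Br D(1) in auto)
  have dn_ge: "0 \<le> disc_norm ((disc_deriv ^^ n) h)" for n
  proof -
    have "bdd_above ((\<lambda>z. norm ((disc_deriv ^^ n) h z)) ` cball 0 1)"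
      by (rule bdd_aboveI2[of _ _ "fact n * B / r ^ n"]) (use Br D(1) in auto)
    then have "norm ((disc_deriv ^^ n) h 0) \<le> disc_norm ((disc_deriv ^^ n) h)"
      unfolding disc_norm_def by (intro cSUP_upper) auto
    then show ?thesis by (meson norm_ge_zero order_trans)
  qed
  have "0 \<le> fact 0 * B / r ^ 0"
    using dn_ge dn_le by (rule order_trans)
  then have "0 \<le> B" by simp
  have "summable (\<lambda>n. disc_norm ((disc_deriv ^^ n) h) / M n)"
  proof (rule summable_comparison_test_ev)
    \<comment> \<open>Any bound below \<open>r\<close> beats the factor \<open>1 / r ^ n\<close> of the Cauchy estimates; \<open>r / 2\<close> leaves a
      geometric series of ratio \<open>1 / 2\<close>.\<close>
    have "\<forall>\<^sub>F n in sequentially. root n (fact n / M n) < r / 2"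
      using assms(2) r unfolding nonanalytic_weight_def by (intro order_tendstoD) auto
    then show "\<forall>\<^sub>F n in sequentially.
      norm (disc_norm ((disc_deriv ^^ n) h) / M n) \<le> B * (1 / 2) ^ n"
      using eventually_gt_at_top[of 0]
    proof eventually_elim
      case (elim n)
      have "fact n / M n = root n (fact n / M n) ^ n"
        using elim(2) M[of n] by simp
      also have "\<dots> \<le> (r / 2) ^ n"
        using elim M[of n] by (intro power_mono) auto
      finally have q: "fact n / M n \<le> (r / 2) ^ n" .
      have "norm (disc_norm ((disc_deriv ^^ n) h) / M n) = disc_norm ((disc_deriv ^^ n) h) / M n"
        using dn_ge[of n] M[of n] by simp
      also have "\<dots> \<le> (fact n * B / r ^ n) / M n"
        using dn_le[of n] M[of n] by (intro divide_right_mono) auto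
      also have "\<dots> = (B / r ^ n) * (fact n / M n)" by simp
      also have "\<dots> \<le> (B / r ^ n) * (r / 2) ^ n"
        using q \<open>0 \<le> B\<close> r by (intro mult_left_mono) auto
      also have "\<dots> = B * (1 / 2) ^ n"
        using r by (simp add: power_divide)
      finally show ?case .
    qed
  qed (auto intro: summable_mult summable_geometric)
  with \<open>h \<in> D_infty\<close> show ?thesis unfolding D_space_def by blast
qed

lemma induces_endomorphism_if_into_open_disc:
  assumes "\<And>n. M n > 0" "nonanalytic_weight M"
    and "analytic_on_closed_disc \<psi>" "\<psi> \<in> cball 0 1 \<rightarrow> ball 0 1"
  shows "induces_endomorphism M \<psi>"
  unfolding induces_endomorphism_def
proof (intro conjI ballI)
  show "\<psi> \<in> cball 0 1 \<rightarrow> cball 0 1"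
    using assms(4) ball_subset_cball by blast
  fix f assume "f \<in> D_space M"
  then have "\<forall>a\<in>cball 0 1. f field_differentiable (at a within cball 0 1)"
    unfolding D_space_def D_infty_def by (auto dest: spec[of _ 0])
  then have "f holomorphic_on ball 0 1"
    by (meson holomorphic_on_def holomorphic_on_subset ball_subset_cball)
  then have "f analytic_on ball 0 1"
    by (simp add: analytic_on_open)
  then have "f analytic_on \<psi> ` cball 0 1"
    by (rule analytic_on_subset) (use assms(4) in blast)
  then have "analytic_on_closed_disc (f \<circ> \<psi>)"
    by (rule analytic_on_closed_disc_compose[OF assms(3)]) simp
  with assms(1,2) show "f \<circ> \<psi> \<in> D_space M"
    by (rule analytic_in_D_space)
qed

section \<open>Boundary behaviour\<close>

lemma unimodular_on_circle_imp_inner_function: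
  assumes "analytic_on_closed_disc \<phi>" "\<phi> \<in> cball 0 1 \<rightarrow> cball 0 1"
    and "\<And>t. norm (\<phi> (cis t)) = 1"
  shows "inner_function \<phi>"
proof -
  have "((\<lambda>r. \<phi> (of_real r * cis t)) \<longlongrightarrow> \<phi> (cis t)) (at_left 1)" for t
  proof (rule continuous_on_tendsto_compose
      [OF analytic_on_closed_disc_imp_continuous_on[OF assms(1)]])
    show "((\<lambda>r. of_real r * cis t) \<longlongrightarrow> cis t) (at_left (1::real))"
      by (auto intro!: tendsto_eq_intros)
    have "\<forall>\<^sub>F r in at_left (1::real). r \<in> {0<..<1}"
      by (rule eventually_at_left_real) simp
    then show "\<forall>\<^sub>F r in at_left (1::real). of_real r * cis t \<in> cball 0 1"
      by eventually_elim (simp add: norm_mult)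
  qed simp
  then have "\<exists>w. ((\<lambda>r. \<phi> (of_real r * cis t)) \<longlongrightarrow> w) (at_left (1::real)) \<and> norm w = 1" for t
    using assms(3) by blast
  moreover have "norm (\<phi> z) \<le> 1" if "z \<in> ball 0 1" for z
    using that assms(2) by fastforce
  ultimately show ?thesis
    unfolding inner_function_def
    using analytic_on_closed_disc_imp_holomorphic_on[OF assms(1)] by simp
qed

text \<open>
  The function \<open>t \<mapsto> \<bar>\<phi>(exp(i t))\<bar>\<^sup>2 - 1\<close> of a real variable extends to a holomorphic function on a
  strip around the real axis, which the identity theorem forces to vanish as soon as its zeros
  accumulate at a real point.
\<close>

lemma finite_unimodular_or_inner:
  assumes "analytic_on_closed_disc \<phi>" "\<phi> \<in> cball 0 1 \<rightarrow> cball 0 1" "\<not> inner_function \<phi>"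
  shows "finite {z \<in> sphere 0 1. norm (\<phi> z) = 1}"
proof (rule ccontr)
  assume inf: "infinite {z \<in> sphere 0 1. norm (\<phi> z) = 1}"
  obtain U g where U: "open U" "cball 0 1 \<subseteq> U" "g holomorphic_on U"
    and gphi: "\<And>z. z \<in> cball 0 1 \<Longrightarrow> g z = \<phi> z"
    using assms(1) unfolding analytic_on_closed_disc_def by metis
  obtain d where d: "d > 0" "(\<Union>x\<in>cball 0 1. ball x d) \<subseteq> U"
    using compact_subset_open_imp_ball_epsilon_subset[OF compact_cball U(1,2)] .
  \<comment> \<open>On the strip of half-width \<open>ln (1 + d)\<close> the values of \<open>exp (\<i> t)\<close> have modulus below \<open>1 + d\<close>.\<close>
  define S where "S = {t. \<bar>Im t\<bar> < ln (1 + d)}"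
  have S_eq: "S = {t. Im t < ln (1 + d)} \<inter> {t. Im t > - ln (1 + d)}"
    unfolding S_def by auto
  have "open S"
    unfolding S_eq by (intro open_Int open_halfspace_Im_lt open_halfspace_Im_gt)
  have "convex S"
    unfolding S_eq by (intro convex_Int convex_halfspace_Im_lt convex_halfspace_Im_gt)
  have real_S: "of_real t \<in> S" for t
    using d(1) by (simp add: S_def)
  have exp_U: "exp (\<i> * t) \<in> U" if "t \<in> S" for t
  proof -
    have "norm (exp (\<i> * t)) = exp (- Im t)" by simp
    also have "\<dots> < exp (ln (1 + d))" using that by (simp add: S_def del: exp_ln)
    finally have lt: "norm (exp (\<i> * t)) < 1 + d" using d(1) by simp
    define w where "w = exp (\<i> * t)"
    have "\<exists>x\<in>cball 0 1. dist x w < d"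
    proof (cases "norm w \<le> 1")
      case True
      then show ?thesis using d(1) by (intro bexI[of _ w]) auto
    next
      case False
      have "dist (sgn w) w = norm (sgn w - w)" by (simp add: dist_norm)
      also have "sgn w - w = (1 - norm w) *\<^sub>R sgn w"
      proof -
        have "w \<noteq> 0" using False by auto
        then have "norm w *\<^sub>R sgn w = w" by (simp add: sgn_div_norm)
        then show ?thesis by (simp add: scaleR_left_diff_distrib)
      qed
      also have "norm ((1 - norm w) *\<^sub>R sgn w) = norm w - 1"
        using False by (auto simp: norm_sgn)
      also have "\<dots> < d" using lt by (simp add: w_def)
      finally show ?thesis by (intro bexI[of _ "sgn w"]) (auto simp: norm_sgn)
    qed
    then show ?thesis using d(2) unfolding w_def mem_ball[symmetric] by blast
  qed
  define G where "G = (\<lambda>t. g (exp (\<i> * t)))"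
  have G: "G holomorphic_on S"
    unfolding G_def using exp_U U(3)
    by (intro holomorphic_on_compose_gen[of "\<lambda>t. exp (\<i> * t)" S g U, unfolded o_def])
       (auto intro!: holomorphic_intros)
  have "cnj ` S = S"
    unfolding image_cnj_conv_vimage_cnj by (auto simp: S_def)
  then have "cnj \<circ> G \<circ> cnj holomorphic_on S"
    using G \<open>open S\<close> by (intro holomorphic_on_compose_cnj_cnj) simp_all
  then have F: "(\<lambda>t. G t * (cnj \<circ> G \<circ> cnj) t - 1) holomorphic_on S"
    using G by (intro holomorphic_intros)
  have F_real: "G (of_real t) * (cnj \<circ> G \<circ> cnj) (of_real t) - 1
      = of_real ((norm (\<phi> (cis t)))\<^sup>2 - 1)" for t
    using gphi[of "cis t"] complex_norm_square[of "\<phi> (cis t)"]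
    by (simp add: G_def cis_conv_exp)
  define T where "T = {t \<in> {0..2*pi}. norm (\<phi> (cis t)) = 1}"
  have "{z \<in> sphere 0 1. norm (\<phi> z) = 1} \<subseteq> cis ` T"
  proof
    fix z assume z: "z \<in> {z \<in> sphere 0 1. norm (\<phi> z) = 1}"
    then have "z = cis (Arg2pi z)"
      using complex_norm_eq_1_exp[of z] Arg2pi_eq[of z] by (simp add: cis_conv_exp)
    moreover have "Arg2pi z \<in> {0..2*pi}"
      using Arg2pi_ge_0[of z] Arg2pi_lt_2pi[of z] by simp
    ultimately show "z \<in> cis ` T"
      using z unfolding T_def by (intro image_eqI[of _ _ "Arg2pi z"]) auto
  qed
  with inf have "infinite T"
    by (meson finite_imageI finite_subset)
  then have "infinite (complex_of_real ` T)"
    by (simp add: finite_image_iff inj_on_def)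
  moreover have "compact (complex_of_real ` {0..2*pi})"
    by (intro compact_continuous_image continuous_intros compact_Icc)
  moreover have "complex_of_real ` T \<subseteq> complex_of_real ` {0..2*pi}"
    unfolding T_def by blast
  ultimately obtain \<xi> where "\<xi> \<in> complex_of_real ` {0..2*pi}" "\<xi> islimpt complex_of_real ` T"
    using Heine_Borel_imp_Bolzano_Weierstrass by metis
  note \<xi> = this
  have "\<xi> \<in> S" "complex_of_real ` T \<subseteq> S"
    using \<xi>(1) real_S by blast+
  moreover have "G w * (cnj \<circ> G \<circ> cnj) w - 1 = 0" if w: "w \<in> complex_of_real ` T" for w
  proof -
    obtain t where t: "w = of_real t" "norm (\<phi> (cis t)) = 1"
      using w unfolding T_def by blast
    show ?thesis unfolding t(1) F_real t(2) by simp
  qed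
  ultimately have "G (of_real t) * (cnj \<circ> G \<circ> cnj) (of_real t) - 1 = 0" for t
    using analytic_continuation[OF F \<open>open S\<close> convex_connected[OF \<open>convex S\<close>] _ _ \<xi>(2) _ real_S]
    by blast
  then have "(norm (\<phi> (cis t)))\<^sup>2 - 1 = 0" for t
    unfolding F_real by (simp only: of_real_eq_0_iff)
  then have "norm (\<phi> (cis t)) = 1" for t
    by (simp add: abs_square_eq_1)
  then have "inner_function \<phi>"
    by (rule unimodular_on_circle_imp_inner_function[OF assms(1,2)])
  with assms(3) show False by contradiction
qed

lemma unimodular_value_imp_on_circle:
  assumes "analytic_on_closed_disc \<phi>" "\<phi> \<in> cball 0 1 \<rightarrow> cball 0 1"
    and nofix: "\<And>z. z \<in> sphere 0 1 \<Longrightarrow> \<phi> z \<noteq> z"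
    and z: "z \<in> cball 0 1" "norm (\<phi> z) = 1"
  shows "z \<in> sphere 0 1"
proof (rule ccontr)
  assume "z \<notin> sphere 0 1"
  with z(1) have "z \<in> ball 0 1" by auto
  have le: "norm (\<phi> w) \<le> norm (\<phi> z)" if "w \<in> ball 0 1" for w
    using that assms(2) z(2) by fastforce
  have "\<phi> constant_on ball 0 1"
    by (rule maximum_modulus_principle[OF analytic_on_closed_disc_imp_holomorphic_on[OF assms(1)],
          of "ball 0 1" z])
       (use \<open>z \<in> ball 0 1\<close> le in auto)
  then have const: "\<phi> w = \<phi> z" if "w \<in> ball 0 1" for w
    using that \<open>z \<in> ball 0 1\<close> unfolding constant_on_def by metis
  have "continuous_on (closure (ball 0 1)) \<phi>"
    using analytic_on_closed_disc_imp_continuous_on[OF assms(1)] by simp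
  then have "\<phi> (\<phi> z) = \<phi> z"
    by (rule continuous_constant_on_closure) (use const z(2) in auto)
  with nofix[of "\<phi> z"] z(2) show False by simp
qed

section \<open>Iterates\<close>

lemma iterates_into_open_disc:
  assumes "analytic_on_closed_disc \<phi>" "\<phi> \<in> cball 0 1 \<rightarrow> cball 0 1" "\<not> inner_function \<phi>"
    and nofix: "\<And>N z. N > 0 \<Longrightarrow> z \<in> sphere 0 1 \<Longrightarrow> (\<phi> ^^ N) z \<noteq> z"
    and N: "N > card {z \<in> sphere 0 1. norm (\<phi> z) = 1}"
  shows "\<phi> ^^ N \<in> cball 0 1 \<rightarrow> ball 0 1"
proof (rule ccontr)
  define E where "E = {z \<in> sphere 0 1. norm (\<phi> z) = 1}"
  have "finite E"
    unfolding E_def using finite_unimodular_or_inner[OF assms(1-3)] .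
  have nofix1: "\<phi> w \<noteq> w" if "w \<in> sphere 0 1" for w
    using nofix[OF zero_less_one that] by simp
  assume "\<phi> ^^ N \<notin> cball 0 1 \<rightarrow> ball 0 1"
  then obtain z where z: "z \<in> cball 0 1" "(\<phi> ^^ N) z \<notin> ball 0 1" by blast
  have orbit: "(\<phi> ^^ i) z \<in> cball 0 1" for i
    using funpow_closed_disc[OF assms(2) z(1)] .
  have sph: "(\<phi> ^^ i) z \<in> sphere 0 1" if "i \<le> N" for i
    using that
  proof (induction i rule: inc_induct)
    case base
    then show ?case using z(2) orbit[of N] by auto
  next
    case (step i)
    then have "norm (\<phi> ((\<phi> ^^ i) z)) = 1" by simp
    with unimodular_value_imp_on_circle[OF assms(1,2) _ orbit] nofix1 show ?case
      by blast
  qed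
  have "(\<phi> ^^ i) z \<in> E" if "i < N" for i
    using sph[of i] sph[of "Suc i"] that unfolding E_def by simp
  then have "(\<lambda>i. (\<phi> ^^ i) z) ` {..<N} \<subseteq> E" by blast
  then have "card ((\<lambda>i. (\<phi> ^^ i) z) ` {..<N}) < card {..<N}"
    using card_mono[OF \<open>finite E\<close>] N unfolding E_def card_lessThan by (meson le_less_trans)
  then have "\<not> inj_on (\<lambda>i. (\<phi> ^^ i) z) {..<N}"
    by (rule pigeonhole)
  then obtain i j where ij: "i < j" "j < N" "(\<phi> ^^ i) z = (\<phi> ^^ j) z"
    using linorder_inj_onI'[of "{..<N}" "\<lambda>i. (\<phi> ^^ i) z"] by auto
  have "(\<phi> ^^ (j - i)) ((\<phi> ^^ i) z) = (\<phi> ^^ (j - i + i)) z"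
    by (simp only: funpow_add o_apply)
  also have "\<dots> = (\<phi> ^^ i) z" using ij by simp
  finally show False
    using nofix[of "j - i" "(\<phi> ^^ i) z"] sph[of i] ij by simp
qed

theorem theorem7:
  fixes M :: "nat \<Rightarrow> real" and \<phi> :: "complex \<Rightarrow> complex"
  assumes "weight_sequence M"
    and "nonanalytic_weight M"
    and "analytic_on_closed_disc \<phi>"
    and "\<phi> \<in> cball 0 1 \<rightarrow> cball 0 1"
    and "\<not> inner_function \<phi>"
    and "\<And>N z. N > 0 \<Longrightarrow> z \<in> sphere 0 1 \<Longrightarrow> (\<phi> ^^ N) z \<noteq> z"
  shows "\<exists>N1. \<forall>N\<ge>N1. induces_endomorphism M (\<phi> ^^ N)"
proof (intro exI allI impI)
  fix N assume "Suc (card {z \<in> sphere 0 1. norm (\<phi> z) = 1}) \<le> N"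
  then have "\<phi> ^^ N \<in> cball 0 1 \<rightarrow> ball 0 1"
    using iterates_into_open_disc[OF assms(3-6)] by simp
  moreover have "\<And>n. M n > 0"
    using assms(1) unfolding weight_sequence_def by blast
  ultimately show "induces_endomorphism M (\<phi> ^^ N)"
    using induces_endomorphism_if_into_open_disc assms(2)
      analytic_on_closed_disc_funpow[OF assms(3,4)] by blast
qed

end
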